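(* (Splitting Lemma) Let $N\ge 1$ and let $f$ be a slice polyanalytic function of order $N$ on an axially symmetric domain $\Omega\subseteq\mathbb{H}$. Then for any imaginary units $I,J\in\mathbb{S}$ with $I\perp J$ there exist functions $F,G:\Omega_I\to\mathbb{C}_I$, polyanalytic of order $N$, such that for all $z=x+Iy\in\Omega_I$ $$f_I(z)=F(z)+G(z)J.$$
   Context: $\mathbb{H}$ denotes the quaternions, $\mathbb{S}=\{q\in\mathbb{H}: q^2=-1\}$, and for $I\in\mathbb{S}$, $\mathbb{C}_I=\mathbb{R}+\mathbb{R}I$ (identified with the complex plane). For $\Omega\subset\mathbb{H}$ put $\Omega_I=\Omega\cap\mathbb{C}_I$, and $f_I$ is the restriction of $f$ to $\Omega_I$. $I\perp J$ means orthogonality in $\mathbb{H}\cong\mathbb{R}^4$. A domain is a nonempty connected open set. An open set $\Omega$ is axially symmetric if $x+Iy\in\Omega$ implies $x+Jy\in\Omega$ for all $J\in\mathbb{S}$. A function $F:\Omega_I\to\mathbb{C}_I$ is polyanalytic of order $N$ if $\left(\frac12(\partial_x+I\partial_y)\right)^N F=0$ on $\Omega_I$. Slice polyanalytic functions: let $\Omega$ be an axially symmetric open set and $\mathcal{U}=\{(x,y)\in\mathbb{R}^2: x+Iy\in\Omega \text{ for all } I\in\mathbb{S}\}$. A function $f:\Omega\to\mathbb{H}$ is a (left) slice function if $f(x+Iy)=\alpha(x,y)+I\beta(x,y)$ for all $x+Iy\in\Omega$, $I\in\mathbb{S}$, where $\alpha,\beta:\mathcal{U}\to\mathbb{H}$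 do not depend on $I$ and satisfy $\alpha(x,-y)=\alpha(x,y)$, $\beta(x,-y)=-\beta(x,y)$. If moreover $\alpha,\beta$ are of class $\mathcal{C}^N$ and $\frac{1}{2^N}(\partial_x+I\partial_y)^N(\alpha(x,y)+I\beta(x,y))=0$ for all $I\in\mathbb{S}$, then $f$ is called (left) slice polyanalytic of order $N$. *)

theory Defs
  imports "HOL-Analysis.Analysis"
begin

section \<open>Quaternions\<close>

codatatype quat = Quat (qRe: real) (qi: real) (qj: real) (qk: real)

lemma quat_eq_iff: "p = q \<longleftrightarrow> qRe p = qRe q \<and> qi p = qi q \<and> qj p = qj q \<and> qk p = qk q"
  by (auto intro: quat.expand)

lemma quat_eqI: "qRe p = qRe q \<Longrightarrow> qi p = qi q \<Longrightarrow> qj p = qj q \<Longrightarrow> qk p = qk q \<Longrightarrow> p = q"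
  by (simp add: quat_eq_iff)

instantiation quat :: ring_1
begin

primcorec zero_quat where
  "qRe 0 = 0" | "qi 0 = 0" | "qj 0 = 0" | "qk 0 = 0"

primcorec one_quat where
  "qRe 1 = 1" | "qi 1 = 0" | "qj 1 = 0" | "qk 1 = 0"

primcorec plus_quat where
  "qRe (p + q) = qRe p + qRe q" | "qi (p + q) = qi p + qi q"
| "qj (p + q) = qj p + qj q" | "qk (p + q) = qk p + qk q"

primcorec uminus_quat where
  "qRe (- p) = - qRe p" | "qi (- p) = - qi p" | "qj (- p) = - qj p" | "qk (- p) = - qk p"

primcorec minus_quat where
  "qRe (p - q) = qRe p - qRe q" | "qi (p - q) = qi p - qi q"
| "qj (p - q) = qj p - qj q" | "qk (p - q) = qk p - qk q"

primcorec times_quat where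
  "qRe (p * q) = qRe p * qRe q - qi p * qi q - qj p * qj q - qk p * qk q"
| "qi (p * q) = qRe p * qi q + qi p * qRe q + qj p * qk q - qk p * qj q"
| "qj (p * q) = qRe p * qj q - qi p * qk q + qj p * qRe q + qk p * qi q"
| "qk (p * q) = qRe p * qk q + qi p * qj q - qj p * qi q + qk p * qRe q"

instance
  by standard (auto simp: quat_eq_iff algebra_simps)

end

instantiation quat :: real_algebra_1
begin

primcorec scaleR_quat where
  "qRe (r *\<^sub>R q) = r * qRe q" | "qi (r *\<^sub>R q) = r * qi q"
| "qj (r *\<^sub>R q) = r * qj q" | "qk (r *\<^sub>R q) = r * qk q"

instance
  by standard (auto simp: quat_eq_iff algebra_simps)

end

text \<open>The norm, topology and inner product are those of \<open>\<real>\<^sup>4\<close>.\<close>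

instantiation quat :: real_normed_div_algebra
begin

definition norm_quat :: "quat \<Rightarrow> real" where
  "norm q = sqrt ((qRe q)\<^sup>2 + (qi q)\<^sup>2 + (qj q)\<^sup>2 + (qk q)\<^sup>2)"

definition dist_quat :: "quat \<Rightarrow> quat \<Rightarrow> real" where
  "dist p q = norm (p - q :: quat)"

definition sgn_quat :: "quat \<Rightarrow> quat" where
  "sgn q = q /\<^sub>R norm (q :: quat)"

definition uniformity_quat :: "(quat \<times> quat) filter" where
  "uniformity = (INF e\<in>{0<..}. principal {(p, q :: quat). dist p q < e})"

definition open_quat :: "quat set \<Rightarrow> bool" where
  "open U \<longleftrightarrow> (\<forall>p\<in>U. eventually (\<lambda>(p', q). p' = p \<longrightarrow> (q :: quat) \<in> U) uniformity)"

definition inverse_quat :: "quat \<Rightarrow> quat" where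
  "inverse q = Quat (qRe q) (- qi q) (- qj q) (- qk q) /\<^sub>R (norm q)\<^sup>2"

definition divide_quat :: "quat \<Rightarrow> quat \<Rightarrow> quat" where
  "p div q = p * inverse (q :: quat)"

instance
proof
  fix p q :: quat and a :: real and U :: "quat set"
  have norm2: "(norm p)\<^sup>2 = (qRe p)\<^sup>2 + (qi p)\<^sup>2 + (qj p)\<^sup>2 + (qk p)\<^sup>2" for p :: quat
    by (simp add: norm_quat_def)
  have norm_prod: "norm p = norm (Complex (qRe p) (qi p), Complex (qj p) (qk p))" for p :: quat
    by (simp add: norm_quat_def norm_Pair cmod_def)
  show norm_0: "norm p = 0 \<longleftrightarrow> p = 0" for p :: quat
    by (simp add: norm_prod quat_eq_iff zero_prod_def complex_eq_iff)
  show "norm (p + q) \<le> norm p + norm q"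
    using norm_triangle_ineq [of "(Complex (qRe p) (qi p), Complex (qj p) (qk p))"
        "(Complex (qRe q) (qi q), Complex (qj q) (qk q))"]
    by (simp add: norm_prod plus_complex.code)
  show "norm (a *\<^sub>R p) = \<bar>a\<bar> * norm p"
    using norm_scaleR [of a "(Complex (qRe p) (qi p), Complex (qj p) (qk p))"]
    by (simp add: norm_prod scaleR_complex.code)
  show "norm (p * q) = norm p * norm q"
    unfolding norm_quat_def real_sqrt_mult [symmetric]
    by (rule arg_cong [of _ _ sqrt]) (simp add: power2_eq_square algebra_simps)
  show "inverse p * p = 1" "p * inverse p = 1" if "p \<noteq> 0"
  proof -
    have "(norm p)\<^sup>2 \<noteq> 0" using that norm_0 by simp
    then have "((qRe p)\<^sup>2 + (qi p)\<^sup>2 + (qj p)\<^sup>2 + (qk p)\<^sup>2) / (norm p)\<^sup>2 = 1"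
      by (simp add: norm2)
    then show "inverse p * p = 1" "p * inverse p = 1"
      by (auto simp: inverse_quat_def quat_eq_iff power2_eq_square add_divide_distrib divide_inverse
          algebra_simps)
  qed
  show "inverse (0 :: quat) = 0"
    by (simp add: inverse_quat_def quat_eq_iff)
qed (rule dist_quat_def sgn_quat_def uniformity_quat_def open_quat_def divide_quat_def)+

end

instantiation quat :: real_inner
begin

definition inner_quat :: "quat \<Rightarrow> quat \<Rightarrow> real" where
  "p \<bullet> q = qRe p * qRe q + qi p * qi q + qj p * qj q + qk p * qk q"

instance
proof
  fix p q r :: quat and a :: real
  show "p \<bullet> q = q \<bullet> p" by (simp add: inner_quat_def mult.commute)
  show "(p + q) \<bullet> r = p \<bullet> r + q \<bullet> r" by (simp add: inner_quat_def algebra_simps)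
  show "(a *\<^sub>R p) \<bullet> q = a * (p \<bullet> q)" by (simp add: inner_quat_def algebra_simps)
  show "0 \<le> p \<bullet> p" by (simp add: inner_quat_def)
  show norm_eq: "norm p = sqrt (p \<bullet> p)"
    by (simp add: norm_quat_def inner_quat_def power2_eq_square)
  show "p \<bullet> p = 0 \<longleftrightarrow> p = 0"
    using norm_eq norm_eq_zero [of p] by simp
qed

end

section \<open>Slices\<close>

definition imag_units :: "quat set" where
  "imag_units = {q. q ^ 2 = - 1}"

definition slice_pt :: "quat \<Rightarrow> real \<times> real \<Rightarrow> quat" where
  "slice_pt I = (\<lambda>(x, y). of_real x + I * of_real y)"

definition slice_plane :: "quat \<Rightarrow> quat set" where
  "slice_plane I = range (slice_pt I)"

definition axially_symmetric :: "quat set \<Rightarrow> bool" where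
  "axially_symmetric \<Omega> \<longleftrightarrow>
     (\<forall>x y. \<forall>I\<in>imag_units. slice_pt I (x, y) \<in> \<Omega> \<longrightarrow> (\<forall>J\<in>imag_units. slice_pt J (x, y) \<in> \<Omega>))"

section \<open>Differentiation in the plane\<close>

definition partial_x :: "(real \<times> real \<Rightarrow> 'a::real_normed_vector) \<Rightarrow> real \<times> real \<Rightarrow> 'a" where
  "partial_x g = (\<lambda>(x, y). vector_derivative (\<lambda>t. g (t, y)) (at x))"

definition partial_y :: "(real \<times> real \<Rightarrow> 'a::real_normed_vector) \<Rightarrow> real \<times> real \<Rightarrow> 'a" where
  "partial_y g = (\<lambda>(x, y). vector_derivative (\<lambda>t. g (x, t)) (at y))"

text \<open>
  Class \<open>C\<^sup>k\<close> on an open set \<open>U\<close>: all iterated partial derivatives of order at most \<open>k\<close>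
  exist and are continuous on \<open>U\<close>. Existence is required explicitly because
  \<^const>\<open>vector_derivative\<close> is a total function.
\<close>

fun C_k_on :: "nat \<Rightarrow> (real \<times> real \<Rightarrow> 'a::real_normed_vector) \<Rightarrow> (real \<times> real) set \<Rightarrow> bool" where
  "C_k_on 0 g U \<longleftrightarrow> continuous_on U g"
| "C_k_on (Suc k) g U \<longleftrightarrow>
     continuous_on U g \<and>
     (\<forall>(x, y)\<in>U. (\<lambda>t. g (t, y)) differentiable (at x) \<and> (\<lambda>t. g (x, t)) differentiable (at y)) \<and>
     C_k_on k (partial_x g) U \<and> C_k_on k (partial_y g) U"

definition dbar :: "quat \<Rightarrow> (real \<times> real \<Rightarrow> quat) \<Rightarrow> real \<times> real \<Rightarrow> quat" where
  "dbar I g = (\<lambda>p. (1/2) *\<^sub>R (partial_x g p + I * partial_y g p))"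

section \<open>Polyanalytic and slice polyanalytic functions\<close>

text \<open>
  A function on \<open>\<Omega> \<inter> slice_plane I\<close> is differentiated in the real coordinates \<open>(x, y)\<close>
  of \<open>x + I y\<close>. Being of class \<open>C\<^sup>N\<close> is part of the definition, so that the
  \<open>N\<close>-th power of the operator is applied to a function for which it makes sense.
\<close>

definition polyanalytic :: "nat \<Rightarrow> quat \<Rightarrow> quat set \<Rightarrow> (quat \<Rightarrow> quat) \<Rightarrow> bool" where
  "polyanalytic N I \<Omega> F \<longleftrightarrow>
     F \<in> \<Omega> \<inter> slice_plane I \<rightarrow> slice_plane I \<and>
     C_k_on N (F \<circ> slice_pt I) {p. slice_pt I p \<in> \<Omega>} \<and>
     (\<forall>p. slice_pt I p \<in> \<Omega> \<longrightarrow> (dbar I ^^ N) (F \<circ> slice_pt I) p = 0)"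

definition slice_params :: "quat set \<Rightarrow> (real \<times> real) set" where
  "slice_params \<Omega> = {p. \<forall>I\<in>imag_units. slice_pt I p \<in> \<Omega>}"

definition slice_rep ::
  "quat set \<Rightarrow> (quat \<Rightarrow> quat) \<Rightarrow> (real \<times> real \<Rightarrow> quat) \<Rightarrow> (real \<times> real \<Rightarrow> quat) \<Rightarrow> bool" where
  "slice_rep \<Omega> f \<alpha> \<beta> \<longleftrightarrow>
     (\<forall>p. \<forall>I\<in>imag_units. slice_pt I p \<in> \<Omega> \<longrightarrow> f (slice_pt I p) = \<alpha> p + I * \<beta> p) \<and>
     (\<forall>(x, y)\<in>slice_params \<Omega>. \<alpha> (x, - y) = \<alpha> (x, y) \<and> \<beta> (x, - y) = - \<beta> (x, y))"

definition slice_polyanalytic :: "nat \<Rightarrow> quat set \<Rightarrow> (quat \<Rightarrow> quat) \<Rightarrow> bool" where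
  "slice_polyanalytic N \<Omega> f \<longleftrightarrow>
     (\<exists>\<alpha> \<beta>. slice_rep \<Omega> f \<alpha> \<beta> \<and>
        C_k_on N \<alpha> (slice_params \<Omega>) \<and> C_k_on N \<beta> (slice_params \<Omega>) \<and>
        (\<forall>I\<in>imag_units. \<forall>p\<in>slice_params \<Omega>. (dbar I ^^ N) (\<lambda>p. \<alpha> p + I * \<beta> p) p = 0))"

end

theory Submission
  imports Defs
begin

text \<open>
  Left multiplication by \<open>I\<close> makes \<open>\<H>\<close> a complex vector space, and the equation
  \<open>(\<partial>\<^sub>x + I \<partial>\<^sub>y)\<^sup>N g = 0\<close> only refers to that structure. Hence it is inherited by
  \<open>T \<circ> g\<close> for every \<open>\<real>\<close>-linear \<open>T\<close> with \<open>T (I q) = I (T q)\<close>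
  (\<open>polyanalytic_complex_linear\<close>). Writing a quaternion as the sum of a part commuting with \<open>I\<close> and a
  part anticommuting with \<open>I\<close>,
  \<open>q = (q - I q I) / 2 + (q + I q I) / 2\<close>,
  both parts are complex linear in \<open>q\<close>. The first lies in \<open>\<complex>\<^sub>I\<close>, the centraliser of \<open>I\<close>
  (\<open>commutes_imp_in_slice_plane\<close>). Since \<open>I \<bottom> J\<close> forces \<open>I J = - J I\<close>, multiplying
  the second from the right by \<open>- J = J\<^sup>-\<^sup>1\<close> again gives an element of \<open>\<complex>\<^sub>I\<close>.
  Applying these two maps to the values of \<open>f\<close> yields \<open>F\<close> and \<open>G\<close>.
\<close>

section \<open>Partial derivatives, sums and linear maps\<close>

lemma eventually_line_in_open:
  fixes U :: "(real \<times> real) set"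
  assumes "open U" "(x, y) \<in> U"
  shows "\<forall>\<^sub>F t in nhds x. (t, y) \<in> U" and "\<forall>\<^sub>F t in nhds y. (x, t) \<in> U"
proof -
  have "open ((\<lambda>t. (t, y)) -` U)" "open ((\<lambda>t. (x, t)) -` U)"
    by (intro open_vimage assms continuous_intros)+
  from this [THEN eventually_nhds_in_open] assms(2)
  show "\<forall>\<^sub>F t in nhds x. (t, y) \<in> U" "\<forall>\<^sub>F t in nhds y. (x, t) \<in> U"
    by simp_all
qed

text \<open>
  The operators \<open>partial_x\<close>, \<open>partial_y\<close> and \<open>dbar\<close> act on total functions, while all identities
  between functions hold on an open set only. The congruence rules make such local
  identities usable under iterated differentiation.
\<close>

lemma partial_cong_open:
  assumes "open U" "\<And>p. p \<in> U \<Longrightarrow> g p = h p" "p \<in> U"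
  shows "partial_x g p = partial_x h p" and "partial_y g p = partial_y h p"
proof -
  obtain x y where p: "p = (x, y)" by (cases p)
  note ev = eventually_line_in_open [OF assms(1), of x y]
  have "\<forall>\<^sub>F t in nhds x. g (t, y) = h (t, y)" "\<forall>\<^sub>F t in nhds y. g (x, t) = h (x, t)"
    using ev assms(2,3) p by (auto elim: eventually_mono)
  then show "partial_x g p = partial_x h p" "partial_y g p = partial_y h p"
    unfolding p partial_x_def partial_y_def prod.case
    by (auto intro!: vector_derivative_cong_eq)
qed

lemma dbar_power_cong_open:
  assumes "open U" "\<And>p. p \<in> U \<Longrightarrow> g p = h p" "p \<in> U"
  shows "(dbar I ^^ k) g p = (dbar I ^^ k) h p"
  using assms(3)
proof (induction k arbitrary: p)
  case 0
  then show ?case using assms(2) by simp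
next
  case (Suc k)
  then show ?case
    using partial_cong_open [OF assms(1) Suc.IH] by (simp add: dbar_def)
qed

lemma C_k_on_cong_open:
  assumes "open U" "\<And>p. p \<in> U \<Longrightarrow> g p = h p" "C_k_on k g U"
  shows "C_k_on k h U"
  using assms(2,3)
proof (induction k arbitrary: g h)
  case 0
  then show ?case by (simp cong: continuous_on_cong)
next
  case (Suc k)
  have "continuous_on U h"
    using Suc.prems by (simp cong: continuous_on_cong)
  moreover have "(\<lambda>t. h (t, y)) differentiable (at x) \<and> (\<lambda>t. h (x, t)) differentiable (at y)"
    if xy: "(x, y) \<in> U" for x y
  proof -
    have "\<forall>\<^sub>F t in nhds x. g (t, y) = h (t, y)" "\<forall>\<^sub>F t in nhds y. g (x, t) = h (x, t)"
      using eventually_line_in_open [OF assms(1) xy] Suc.prems(1) by (auto elim: eventually_mono)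
    then have "\<forall>\<^sub>F t in at x. g (t, y) = h (t, y)" "\<forall>\<^sub>F t in at y. g (x, t) = h (x, t)"
      by (simp_all add: eventually_nhds_conv_at)
    moreover have "(\<lambda>t. g (t, y)) differentiable (at x)" "(\<lambda>t. g (x, t)) differentiable (at y)"
      using Suc.prems(2) xy by auto
    ultimately show ?thesis
      using Suc.prems(1) xy unfolding differentiable_def
      by (blast intro: has_derivative_transform_eventually [where s = UNIV])
  qed
  moreover have "C_k_on k (partial_x h) U" "C_k_on k (partial_y h) U"
    using Suc.prems(2) Suc.IH [of "partial_x g" "partial_x h"]
      Suc.IH [of "partial_y g" "partial_y h"]
      partial_cong_open [OF assms(1) Suc.prems(1)] by auto
  ultimately show ?case by auto
qed

lemma partial_linear:
  assumes "bounded_linear T" "C_k_on (Suc k) g U" "p \<in> U"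
  shows "partial_x (T \<circ> g) p = T (partial_x g p)" and "partial_y (T \<circ> g) p = T (partial_y g p)"
proof -
  obtain x y where p: "p = (x, y)" by (cases p)
  have "(\<lambda>t. g (t, y)) differentiable (at x)" "(\<lambda>t. g (x, t)) differentiable (at y)"
    using assms(2,3) p by auto
  then show "partial_x (T \<circ> g) p = T (partial_x g p)"
      "partial_y (T \<circ> g) p = T (partial_y g p)"
    unfolding p partial_x_def partial_y_def prod.case comp_def
    by (intro vector_derivative_at bounded_linear.has_vector_derivative [OF assms(1)];
        simp add: vector_derivative_works)+
qed

lemma C_k_on_linear:
  assumes "open U" "bounded_linear T" "C_k_on k g U"
  shows "C_k_on k (T \<circ> g) U"
  using assms(3)
proof (induction k arbitrary: g)
  case 0
  then show ?case
    using bounded_linear.continuous_on [OF assms(2)] by (simp add: comp_def)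
next
  case (Suc k)
  have "continuous_on U (T \<circ> g)"
    using Suc.prems bounded_linear.continuous_on [OF assms(2), of U g] by (simp add: comp_def)
  moreover have "(\<lambda>t. T (g (t, y))) differentiable (at x) \<and> (\<lambda>t. T (g (x, t))) differentiable (at y)"
    if "(x, y) \<in> U" for x y
  proof -
    have "(\<lambda>t. g (t, y)) differentiable (at x)" "(\<lambda>t. g (x, t)) differentiable (at y)"
      using Suc.prems that by auto
    then show ?thesis
      using bounded_linear_imp_differentiable [OF assms(2)]
      by (simp add: differentiable_compose [of T])
  qed
  moreover have "C_k_on k (partial_x (T \<circ> g)) U"
    by (rule C_k_on_cong_open [OF assms(1) _ Suc.IH [of "partial_x g"]])
      (use Suc.prems in \<open>simp_all add: partial_linear [OF assms(2) Suc.prems]\<close>)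
  moreover have "C_k_on k (partial_y (T \<circ> g)) U"
    by (rule C_k_on_cong_open [OF assms(1) _ Suc.IH [of "partial_y g"]])
      (use Suc.prems in \<open>simp_all add: partial_linear [OF assms(2) Suc.prems]\<close>)
  ultimately show ?case by (auto simp: comp_def)
qed

lemma partial_add:
  assumes "C_k_on (Suc k) g U" "C_k_on (Suc k) h U" "p \<in> U"
  shows "partial_x (\<lambda>p. g p + h p) p = partial_x g p + partial_x h p"
    and "partial_y (\<lambda>p. g p + h p) p = partial_y g p + partial_y h p"
proof -
  obtain x y where p: "p = (x, y)" by (cases p)
  have "(\<lambda>t. g (t, y)) differentiable (at x)" "(\<lambda>t. g (x, t)) differentiable (at y)"
    "(\<lambda>t. h (t, y)) differentiable (at x)" "(\<lambda>t. h (x, t)) differentiable (at y)"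
    using assms p by auto
  then show "partial_x (\<lambda>p. g p + h p) p = partial_x g p + partial_x h p"
      "partial_y (\<lambda>p. g p + h p) p = partial_y g p + partial_y h p"
    unfolding p partial_x_def partial_y_def prod.case
    by (intro vector_derivative_at has_vector_derivative_add;
        simp add: vector_derivative_works)+
qed

lemma C_k_on_add:
  assumes "open U" "C_k_on k g U" "C_k_on k h U"
  shows "C_k_on k (\<lambda>p. g p + h p) U"
  using assms(2,3)
proof (induction k arbitrary: g h)
  case 0
  then show ?case by (simp add: continuous_on_add)
next
  case (Suc k)
  have "C_k_on k (partial_x (\<lambda>p. g p + h p)) U"
    by (rule C_k_on_cong_open [OF assms(1) _ Suc.IH [of "partial_x g" "partial_x h"]])
      (use Suc.prems in \<open>simp_all add: partial_add [OF Suc.prems]\<close>)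
  moreover have "C_k_on k (partial_y (\<lambda>p. g p + h p)) U"
    by (rule C_k_on_cong_open [OF assms(1) _ Suc.IH [of "partial_y g" "partial_y h"]])
      (use Suc.prems in \<open>simp_all add: partial_add [OF Suc.prems]\<close>)
  moreover have "(\<lambda>t. g (t, y) + h (t, y)) differentiable (at x)"
    "(\<lambda>t. g (x, t) + h (x, t)) differentiable (at y)" if "(x, y) \<in> U" for x y
  proof -
    have "(\<lambda>t. g (t, y)) differentiable (at x)" "(\<lambda>t. g (x, t)) differentiable (at y)"
      "(\<lambda>t. h (t, y)) differentiable (at x)" "(\<lambda>t. h (x, t)) differentiable (at y)"
      using Suc.prems that by auto
    then show "(\<lambda>t. g (t, y) + h (t, y)) differentiable (at x)"
      "(\<lambda>t. g (x, t) + h (x, t)) differentiable (at y)"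
      by (simp_all add: differentiable_add)
  qed
  moreover have "continuous_on U (\<lambda>p. g p + h p)"
    using Suc.prems by (intro continuous_on_add) simp_all
  ultimately show ?case by auto
qed

lemma C_k_on_dbar:
  assumes "open U" "C_k_on (Suc k) g U"
  shows "C_k_on k (dbar I g) U"
proof -
  have half: "bounded_linear (\<lambda>q :: quat. (1/2) *\<^sub>R q)"
    and half_I: "bounded_linear (\<lambda>q :: quat. (1/2) *\<^sub>R (I * q))"
    by (intro bounded_linear_intros)+
  have "dbar I g = (\<lambda>p. ((\<lambda>q. (1/2) *\<^sub>R q) \<circ> partial_x g) p
                      + ((\<lambda>q. (1/2) *\<^sub>R (I * q)) \<circ> partial_y g) p)"
    by (simp add: dbar_def fun_eq_iff scaleR_add_right)
  then show ?thesis
    using assms(2)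
    by (auto intro!: C_k_on_add C_k_on_linear half half_I assms(1) simp del: comp_apply)
qed

section \<open>Complex linear maps and polyanalyticity\<close>

text \<open>
  This is where complex linearity enters: an \<open>\<real>\<close>-linear map commutes with the partial
  derivatives, and commuting with left multiplication by \<open>I\<close> lets it pass through the
  factor \<open>I\<close> of \<open>dbar I\<close>.
\<close>

lemma dbar_power_complex_linear:
  assumes "open U" "bounded_linear T" "\<And>q. T (I * q) = I * T q"
    and "C_k_on k g U" "p \<in> U"
  shows "(dbar I ^^ k) (T \<circ> g) p = T ((dbar I ^^ k) g p)"
  using assms(4)
proof (induction k arbitrary: g)
  case 0
  then show ?case by simp
next
  case (Suc k)
  interpret T: bounded_linear T by fact
  have "dbar I (T \<circ> g) p = (T \<circ> dbar I g) p" if "p \<in> U" for p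
    by (simp only: comp_apply dbar_def partial_linear [OF assms(2) Suc.prems that]
        T.scaleR T.add assms(3))
  then have "(dbar I ^^ k) (dbar I (T \<circ> g)) p = (dbar I ^^ k) (T \<circ> dbar I g) p"
    by (rule dbar_power_cong_open [OF assms(1) _ assms(5)])
  also have "\<dots> = T ((dbar I ^^ k) (dbar I g) p)"
    using Suc.IH C_k_on_dbar [OF assms(1) Suc.prems] by blast
  finally show ?case
    by (simp only: funpow_Suc_right comp_apply [of "dbar I ^^ k"])
qed

lemma polyanalytic_complex_linear:
  assumes "open {p. slice_pt I p \<in> \<Omega>}"
    and "bounded_linear T" "\<And>q. T (I * q) = I * T q" "range T \<subseteq> slice_plane I"
    and "C_k_on N (f \<circ> slice_pt I) {p. slice_pt I p \<in> \<Omega>}"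
    and "\<And>p. slice_pt I p \<in> \<Omega> \<Longrightarrow> (dbar I ^^ N) (f \<circ> slice_pt I) p = 0"
  shows "polyanalytic N I \<Omega> (T \<circ> f)"
  unfolding polyanalytic_def
proof (intro conjI allI impI)
  show "T \<circ> f \<in> \<Omega> \<inter> slice_plane I \<rightarrow> slice_plane I"
    using assms(4) by auto
  show "C_k_on N (T \<circ> f \<circ> slice_pt I) {p. slice_pt I p \<in> \<Omega>}"
    unfolding comp_assoc using assms(1,2,5) by (rule C_k_on_linear)
  fix p assume p: "slice_pt I p \<in> \<Omega>"
  have "(dbar I ^^ N) (T \<circ> (f \<circ> slice_pt I)) p = T ((dbar I ^^ N) (f \<circ> slice_pt I) p)"
    using assms(1-3,5) by (rule dbar_power_complex_linear) (use p in simp)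
  then show "(dbar I ^^ N) (T \<circ> f \<circ> slice_pt I) p = 0"
    using assms(6) [OF p] bounded_linear.linear [OF assms(2), THEN linear_0]
    by (simp add: comp_assoc)
qed

section \<open>Imaginary units\<close>

lemma imag_units_iff:
  "I \<in> imag_units \<longleftrightarrow> qRe I = 0 \<and> (qi I)\<^sup>2 + (qj I)\<^sup>2 + (qk I)\<^sup>2 = 1"
proof
  assume "I \<in> imag_units"
  then have *: "qRe I * qRe I - qi I * qi I - qj I * qj I - qk I * qk I = -1"
    "qRe I * qi I = 0" "qRe I * qj I = 0" "qRe I * qk I = 0"
    by (auto simp: imag_units_def quat_eq_iff power2_eq_square)
  have "qRe I = 0"
  proof (rule ccontr)
    assume "qRe I \<noteq> 0"
    with * have "qRe I * qRe I = -1" by simp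
    then show False using zero_le_square [of "qRe I"] by linarith
  qed
  with * show "qRe I = 0 \<and> (qi I)\<^sup>2 + (qj I)\<^sup>2 + (qk I)\<^sup>2 = 1"
    by (simp add: power2_eq_square)
next
  assume "qRe I = 0 \<and> (qi I)\<^sup>2 + (qj I)\<^sup>2 + (qk I)\<^sup>2 = 1"
  then show "I \<in> imag_units"
    by (simp add: imag_units_def quat_eq_iff power2_eq_square)
qed

lemma orthogonal_imag_units_anticommute:
  assumes "I \<in> imag_units" "J \<in> imag_units" "orthogonal I J"
  shows "J * I = - (I * J)"
  using assms
  by (auto simp: imag_units_iff quat_eq_iff orthogonal_def inner_quat_def algebra_simps)

text \<open>
  The commutator of \<open>q\<close> and \<open>I\<close> is twice the cross product of their vector parts. When it
  vanishes, the vector part of \<open>q\<close> is a multiple of the unit vector \<open>I\<close>, with coefficient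
  \<open>I \<bullet> q\<close>.
\<close>

lemma commutes_imp_in_slice_plane:
  assumes "I \<in> imag_units" "I * q = q * I"
  shows "q \<in> slice_plane I"
proof -
  define a b c where "a = qi I" "b = qj I" "c = qk I"
  define u v w where "u = qi q" "v = qj q" "w = qk q"
  note defs = a_b_c_def u_v_w_def
  have I: "qRe I = 0" "a\<^sup>2 + b\<^sup>2 + c\<^sup>2 = 1"
    using assms(1) by (simp_all add: imag_units_iff defs)
  have cross: "b * w = c * v" "c * u = a * w" "a * v = b * u"
    using assms(2) I(1) by (auto simp: quat_eq_iff defs algebra_simps)
  have "a * (a * u + b * v + c * w) = (a\<^sup>2 + b\<^sup>2 + c\<^sup>2) * u"
    "b * (a * u + b * v + c * w) = (a\<^sup>2 + b\<^sup>2 + c\<^sup>2) * v"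
    "c * (a * u + b * v + c * w) = (a\<^sup>2 + b\<^sup>2 + c\<^sup>2) * w"
    using cross by algebra+
  then have "q = slice_pt I (qRe q, I \<bullet> q)"
    using I by (simp add: quat_eq_iff slice_pt_def of_real_def inner_quat_def defs mult.commute)
  then show ?thesis
    unfolding slice_plane_def by blast
qed

lemma open_slice_pt_vimage:
  assumes "open \<Omega>"
  shows "open {p. slice_pt I p \<in> \<Omega>}"
proof -
  have "open (slice_pt I -` \<Omega>)"
    unfolding slice_pt_def case_prod_beta by (intro open_vimage assms continuous_intros)
  then show ?thesis by (simp add: vimage_def)
qed

lemma slice_params_eq:
  assumes "axially_symmetric \<Omega>" "I \<in> imag_units"
  shows "slice_params \<Omega> = {p. slice_pt I p \<in> \<Omega>}"
  using assms unfolding slice_params_def axially_symmetric_def by auto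

section \<open>The splitting lemma\<close>

theorem proposition3p4:
  fixes N :: nat and \<Omega> :: "quat set" and f :: "quat \<Rightarrow> quat" and I J :: quat
  assumes "N \<ge> 1"
    and "open \<Omega>" and "connected \<Omega>" and "\<Omega> \<noteq> {}"
    and "axially_symmetric \<Omega>"
    and "slice_polyanalytic N \<Omega> f"
    and "I \<in> imag_units" and "J \<in> imag_units" and "orthogonal I J"
  shows "\<exists>F G. polyanalytic N I \<Omega> F \<and> polyanalytic N I \<Omega> G \<and>
           (\<forall>z \<in> \<Omega> \<inter> slice_plane I. f z = F z + G z * J)"
proof -
  define U where "U = {p. slice_pt I p \<in> \<Omega>}"
  have U: "open U" "slice_params \<Omega> = U"
    using assms open_slice_pt_vimage slice_params_eq by (auto simp: U_def)
  obtain \<alpha> \<beta> where rep: "slice_rep \<Omega> f \<alpha> \<beta>"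
    and ck: "C_k_on N \<alpha> U" "C_k_on N \<beta> U"
    and poly: "\<And>p. p \<in> U \<Longrightarrow> (dbar I ^^ N) (\<lambda>p. \<alpha> p + I * \<beta> p) p = 0"
    using assms(6,7) U(2) unfolding slice_polyanalytic_def by blast
  have f_eq: "\<alpha> p + I * \<beta> p = (f \<circ> slice_pt I) p" if "p \<in> U" for p
    using rep assms(7) that by (cases p) (simp add: slice_rep_def U_def)
  have "C_k_on N (\<lambda>p. \<alpha> p + ((*) I \<circ> \<beta>) p) U"
    by (intro C_k_on_add C_k_on_linear U ck bounded_linear_mult_right)
  then have f_ck: "C_k_on N (f \<circ> slice_pt I) U"
    by (rule C_k_on_cong_open [OF U(1), rotated]) (use f_eq in simp)
  have f_poly: "(dbar I ^^ N) (f \<circ> slice_pt I) p = 0" if "p \<in> U" for p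
  proof -
    have "(dbar I ^^ N) (\<lambda>p. \<alpha> p + I * \<beta> p) p = (dbar I ^^ N) (f \<circ> slice_pt I) p"
      using f_eq that by (rule dbar_power_cong_open [OF U(1)])
    then show ?thesis using poly [OF that] by simp
  qed

  have II: "I * I = -1" and JJ: "J * J = -1"
    using assms(7,8) by (auto simp: imag_units_def power2_eq_square)
  have IIq: "I * (I * q) = - q" for q
    by (simp add: II flip: mult.assoc)
  have JI: "J * I = - (I * J)"
    using assms(7-9) by (rule orthogonal_imag_units_anticommute)

  define S where "S = (\<lambda>q. (1/2) *\<^sub>R (q - I * q * I))"
  define T where "T = (\<lambda>q. (-1/2) *\<^sub>R ((q + I * q * I) * J))"
  have lin: "bounded_linear S" "bounded_linear T"
    unfolding S_def T_def by (intro bounded_linear_intros)+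
  have clin: "S (I * q) = I * S q" "T (I * q) = I * T q" for q
    by (simp_all add: S_def T_def algebra_simps IIq II)
  have "I * S q = S q * I" "I * T q = T q * I" for q
    by (simp_all add: S_def T_def algebra_simps IIq II JI)
  then have range: "range S \<subseteq> slice_plane I" "range T \<subseteq> slice_plane I"
    using commutes_imp_in_slice_plane [OF assms(7)] by auto
  have "S q + T q * J = q" for q
  proof -
    have "T q * J = (-1/2) *\<^sub>R ((q + I * q * I) * (J * J))"
      by (simp only: T_def mult_scaleR_left mult.assoc)
    then have "T q * J = (1/2) *\<^sub>R (q + I * q * I)"
      by (simp add: JJ scaleR_right_distrib scaleR_right_diff_distrib)
    then have "S q + T q * J = (1/2) *\<^sub>R (q + q)"
      by (simp add: S_def flip: scaleR_add_right)
    then show ?thesis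
      by (simp flip: scaleR_2)
  qed
  moreover have "polyanalytic N I \<Omega> (S \<circ> f)" "polyanalytic N I \<Omega> (T \<circ> f)"
    using U(1) lin clin range f_ck f_poly unfolding U_def
    by (auto intro: polyanalytic_complex_linear simp del: comp_apply)
  ultimately show ?thesis
    by (intro exI [of _ "S \<circ> f"] exI [of _ "T \<circ> f"]) simp
qed

end
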